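(* Let $k\in\mathbb N$, $k\ge 1$, and let $u_k:\mathbb R^2_+\to\mathbb R$ be given by $$u_k(x,y)=\left(\frac1\pi\arctan\left(\frac xy\right)+\frac12\right)\mathrm{Re}\big((x+iy)^k\big)-\frac1\pi\log\big(\sqrt{x^2+y^2}\big)\,\mathrm{Im}\big((x+iy)^k\big).$$ Then $u_k\notin\mathcal B_k(\mathbb R^2_+)$.
   Context: $\mathbb R^2_+=\{(x,y)\in\mathbb R^2: y>0\}$. For $\alpha>0$ let $\sigma_\alpha(z)=\max\{z,0\}^\alpha$ for $z\in\mathbb R$. For a Borel probability measure $\pi$ on $\mathbb R\times\mathbb R^d\times\mathbb R$ set $f_{\pi,\alpha}(x)=\mathbb E_{(a,w,b)\sim\pi}[a\,\sigma_\alpha(w^Tx+b)]$, $x\in\mathbb R^d$. For $D\subseteq\mathbb R^d$ and a continuous function $f:D\to\mathbb R$, $$\|f\|_{\mathcal B_\alpha(D)}=\inf\{\mathbb E_{(a,w,b)\sim\pi}[|a|(|w|+|b|)^\alpha] : f(x)=f_{\pi,\alpha}(x)\text{ for all }x\in D\},$$ and $\mathcal B_\alpha(D)=\{f\in C^0(D):\|f\|_{\mathcal B_\alpha(D)}<\infty\}$ (the $\mathrm{ReLU}^\alpha$-Barron space over $D$). *)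

theory Defs
  imports "HOL-Probability.Probability"
begin

text \<open>
  The space $R^d$ is an arbitrary Euclidean space \<^typ>\<open>'a\<close>; the parameter $\alpha$ is
  meant to be positive, so that \<open>0 powr \<alpha> = 0\<close> is the intended value of the power.
  A function on \<open>D\<close> is represented by a total function of which only the values
  on \<open>D\<close> matter.
\<close>

definition relu_pow :: "real \<Rightarrow> real \<Rightarrow> real" where
  "relu_pow \<alpha> z = max z 0 powr \<alpha>"

definition borel_prob_measures :: "'b::topological_space measure set" where
  "borel_prob_measures = {\<pi>. prob_space \<pi> \<and> sets \<pi> = sets borel}"

definition barron_integrand :: "real \<Rightarrow> 'a::euclidean_space \<Rightarrow> real \<times> 'a \<times> real \<Rightarrow> real" where
  "barron_integrand \<alpha> x = (\<lambda>(a, w, b). a * relu_pow \<alpha> (w \<bullet> x + b))"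

definition barron_fun :: "(real \<times> 'a::euclidean_space \<times> real) measure \<Rightarrow> real \<Rightarrow> 'a \<Rightarrow> real" where
  "barron_fun \<pi> \<alpha> x = (\<integral>p. barron_integrand \<alpha> x p \<partial>\<pi>)"

text \<open>
  The Bochner integral is 0 for non-integrable functions, so the existence of the expectation
  is required explicitly. (It follows from finiteness of the moment below.)
\<close>

definition barron_represents ::
  "'a::euclidean_space set \<Rightarrow> real \<Rightarrow> (real \<times> 'a \<times> real) measure \<Rightarrow> ('a \<Rightarrow> real) \<Rightarrow> bool" where
  "barron_represents D \<alpha> \<pi> f \<longleftrightarrow>
     (\<forall>x\<in>D. integrable \<pi> (barron_integrand \<alpha> x) \<and> f x = barron_fun \<pi> \<alpha> x)"

definition barron_moment :: "real \<Rightarrow> (real \<times> 'a::euclidean_space \<times> real) measure \<Rightarrow> ennreal" where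
  "barron_moment \<alpha> \<pi> = (\<integral>\<^sup>+(a, w, b). ennreal (\<bar>a\<bar> * (norm w + \<bar>b\<bar>) powr \<alpha>) \<partial>\<pi>)"

text \<open>The infimum over the empty set is \<open>\<infinity>\<close>.\<close>

definition barron_norm :: "real \<Rightarrow> 'a::euclidean_space set \<Rightarrow> ('a \<Rightarrow> real) \<Rightarrow> ennreal" where
  "barron_norm \<alpha> D f =
     (INF \<pi>\<in>{\<pi>\<in>borel_prob_measures. barron_represents D \<alpha> \<pi> f}. barron_moment \<alpha> \<pi>)"

definition barron_space :: "real \<Rightarrow> 'a::euclidean_space set \<Rightarrow> ('a \<Rightarrow> real) set" where
  "barron_space \<alpha> D = {f. continuous_on D f \<and> barron_norm \<alpha> D f < \<infinity>}"

definition upper_half_plane :: "(real \<times> real) set" where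
  "upper_half_plane = {(x, y). y > 0}"

definition u :: "nat \<Rightarrow> real \<times> real \<Rightarrow> real" where
  "u k = (\<lambda>(x, y).
     (1 / pi * arctan (x / y) + 1 / 2) * Re ((complex_of_real x + \<i> * complex_of_real y) ^ k)
     - 1 / pi * ln (sqrt (x\<^sup>2 + y\<^sup>2)) * Im ((complex_of_real x + \<i> * complex_of_real y) ^ k))"

end

theory Submission
  imports Defs
begin

text \<open>
  A function with a finite Barron moment \<open>M\<close> satisfies \<open>\<bar>f x\<bar> \<le> R\<^sup>\<alpha> M\<close> whenever \<open>\<bar>x\<bar> \<le> R\<close> and
  \<open>R \<ge> 1\<close>. But on the ray of angle \<open>\<pi>/(2k)\<close> the \<open>k\<close>-th power of \<open>x + iy\<close> is \<open>i R\<^sup>k\<close>, so there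
  \<open>u k\<close> equals \<open>- R\<^sup>k (ln R) / \<pi>\<close>, which outgrows \<open>R\<^sup>k\<close>.
\<close>

text \<open>Cauchy-Schwarz bounds \<open>w \<bullet> x\<close> by \<open>R * norm w\<close>, and
  \<open>1 \<le> R\<close> lets the same factor absorb the bias \<open>b\<close>. The power then
  pulls \<open>R\<close> out as \<open>R powr \<alpha>\<close>.\<close>

lemma abs_barron_integrand_le:
  assumes "norm x \<le> R" "1 \<le> R" "0 \<le> \<alpha>"
  shows "\<bar>barron_integrand \<alpha> x (a, w, b)\<bar> \<le> R powr \<alpha> * (\<bar>a\<bar> * (norm w + \<bar>b\<bar>) powr \<alpha>)"
proof -
  have "w \<bullet> x \<le> norm w * R"
    using norm_cauchy_schwarz[of w x] mult_left_mono[OF assms(1), of "norm w"] by simp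
  moreover have "\<bar>b\<bar> \<le> R * \<bar>b\<bar>"
    using mult_right_mono[OF assms(2), of "\<bar>b\<bar>"] by simp
  ultimately have "w \<bullet> x + b \<le> R * (norm w + \<bar>b\<bar>)"
    by (simp add: algebra_simps)
  then have "max (w \<bullet> x + b) 0 \<le> R * (norm w + \<bar>b\<bar>)"
    using assms by simp
  then have "max (w \<bullet> x + b) 0 powr \<alpha> \<le> (R * (norm w + \<bar>b\<bar>)) powr \<alpha>"
    using assms by (intro powr_mono2) auto
  also have "\<dots> = R powr \<alpha> * (norm w + \<bar>b\<bar>) powr \<alpha>"
    using assms by (simp add: powr_mult)
  finally have "\<bar>a\<bar> * max (w \<bullet> x + b) 0 powr \<alpha>
      \<le> \<bar>a\<bar> * (R powr \<alpha> * (norm w + \<bar>b\<bar>) powr \<alpha>)"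
    by (intro mult_left_mono) auto
  then show ?thesis
    by (simp add: barron_integrand_def relu_pow_def abs_mult mult.left_commute)
qed

lemma abs_barron_fun_le:
  fixes \<pi> :: "(real \<times> 'a::euclidean_space \<times> real) measure"
  assumes "sets \<pi> = sets borel" "integrable \<pi> (barron_integrand \<alpha> x)"
    and "barron_moment \<alpha> \<pi> < \<infinity>" "norm x \<le> R" "1 \<le> R" "0 \<le> \<alpha>"
  shows "\<bar>barron_fun \<pi> \<alpha> x\<bar> \<le> R powr \<alpha> * enn2real (barron_moment \<alpha> \<pi>)"
proof -
  \<comment> \<open>The Borel sets of the product space are the product of the Borel sigma-algebras,
    so the moment integrand is measurable and the constant can leave the integral.\<close>
  have [measurable_cong]: "sets \<pi> = sets ((borel :: real measure) \<Otimes>\<^sub>M (borel :: 'a measure) \<Otimes>\<^sub>M (borel :: real measure))"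
    by (simp only: assms(1) borel_prod)
  have "ennreal \<bar>barron_fun \<pi> \<alpha> x\<bar> \<le> (\<integral>\<^sup>+p. ennreal \<bar>barron_integrand \<alpha> x p\<bar> \<partial>\<pi>)"
    using integral_norm_bound_ennreal[OF assms(2)] by (simp add: barron_fun_def)
  also have "\<dots> \<le> (\<integral>\<^sup>+p. ennreal (R powr \<alpha>) *
      (case p of (a, w, b) \<Rightarrow> ennreal (\<bar>a\<bar> * (norm w + \<bar>b\<bar>) powr \<alpha>)) \<partial>\<pi>)"
    using abs_barron_integrand_le[OF assms(4-6)]
    by (intro nn_integral_mono) (auto simp: ennreal_mult[symmetric])
  also have "\<dots> = ennreal (R powr \<alpha>) * barron_moment \<alpha> \<pi>"
    unfolding barron_moment_def by (intro nn_integral_cmult) measurable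
  \<comment> \<open>Finiteness of the moment matters here: \<open>enn2real\<close> sends infinity to
    0.\<close>
  also have "\<dots> = ennreal (R powr \<alpha> * enn2real (barron_moment \<alpha> \<pi>))"
    using assms(3) by (simp add: ennreal_mult)
  finally show ?thesis
    by (simp add: ennreal_le_iff)
qed

text \<open>By De Moivre the angle is multiplied by \<open>k\<close> and becomes
  \<open>pi / 2\<close>. The real part of the power vanishes, and the arctan term with it; only the
  logarithmic term survives.\<close>

lemma u_on_ray:
  assumes "k \<ge> 1" "R > 0"
  shows "u k (R * cos (pi / (2 * k)), R * sin (pi / (2 * k))) = - (R ^ k * ln R / pi)"
proof -
  let ?t = "pi / (2 * real k)"
  have "complex_of_real (R * cos ?t) + \<i> * complex_of_real (R * sin ?t) = of_real R * cis ?t"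
    by (simp add: complex_eq_iff)
  moreover have "(of_real R * cis ?t) ^ k = of_real (R ^ k) * \<i>"
    using assms by (simp add: power_mult_distrib Complex.DeMoivre)
  moreover have "(R * cos ?t)\<^sup>2 + (R * sin ?t)\<^sup>2 = R\<^sup>2"
    by (simp add: power_mult_distrib flip: distrib_left)
  ultimately show ?thesis
    using assms by (simp add: u_def)
qed

theorem lemma3p9:
  fixes k :: nat
  assumes "k \<ge> 1"
  shows "u k \<notin> barron_space (real k) upper_half_plane"
proof
  assume "u k \<in> barron_space (real k) upper_half_plane"
  then obtain \<pi> where \<pi>: "sets \<pi> = sets borel" "barron_moment (real k) \<pi> < \<infinity>"
    and rep: "barron_represents upper_half_plane (real k) \<pi> (u k)"
    by (auto simp: barron_space_def barron_norm_def borel_prob_measures_def Inf_less_iff)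
  define M where "M = enn2real (barron_moment (real k) \<pi>)"
  \<comment> \<open>Chosen so that \<open>ln R / pi = M + 1\<close>, which just exceeds the constant
    \<open>M\<close> of the growth bound.\<close>
  define R where "R = exp (pi * (M + 1))"
  define x where "x = (R * cos (pi / (2 * k)), R * sin (pi / (2 * k)))"
  have "M \<ge> 0"
    by (simp add: M_def)
  then have "R \<ge> 1"
    by (simp add: R_def)
  \<comment> \<open>The sine is positive on this range, so the ray lies in the open half-plane; for
    \<open>k = 1\<close> it is the vertical axis.\<close>
  have "0 < pi / (2 * k)" "pi / (2 * k) < pi"
    using assms by (auto simp: field_simps)
  then have "x \<in> upper_half_plane"
    using \<open>R \<ge> 1\<close> by (simp add: x_def upper_half_plane_def sin_gt_zero)
  then have "integrable \<pi> (barron_integrand (real k) x)" "u k x = barron_fun \<pi> (real k) x"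
    using rep by (auto simp: barron_represents_def)
  moreover have "norm x \<le> R"
    using \<open>R \<ge> 1\<close> by (simp add: x_def norm_Pair power_mult_distrib flip: distrib_left)
  ultimately have "\<bar>u k x\<bar> \<le> R powr real k * M"
    using abs_barron_fun_le[OF \<pi>(1) _ \<pi>(2) _ \<open>R \<ge> 1\<close>] by (simp add: M_def)
  moreover have "\<bar>u k x\<bar> = R ^ k * (M + 1)"
    using u_on_ray[OF assms, of R] \<open>R \<ge> 1\<close> \<open>M \<ge> 0\<close> by (simp add: x_def R_def abs_mult)
  ultimately have "R ^ k * (M + 1) \<le> R ^ k * M"
    using \<open>R \<ge> 1\<close> by (simp add: powr_realpow)
  then show False
    using \<open>R \<ge> 1\<close> by simp
qed

end
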